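(* Let $\mathfrak{r}_{3,1}$ be the complex Lie algebra on $\mathbb{C}^3$ with canonical basis $\{e_1,e_2,e_3\}$ and nonzero brackets $[e_1,e_2]=e_2$, $[e_1,e_3]=e_3$. Any hom-Lie algebra $(\mathfrak{r}_{3,1},A)$ with nilpotent twisting map is isomorphic to some hom-Lie algebra $\mathfrak{L}_3^i:=(\mathfrak{r}_{3,1},A_i)$, $i\in\{0,1,2,3\}$, where $A_0$ is the zero map and the matrices of the other $A_i$ with respect to the ordered basis $\{e_1,e_2,e_3\}$ are $$A_1=\begin{pmatrix}0&0&0\\1&0&0\\0&0&0\end{pmatrix},\quad A_2=\begin{pmatrix}0&0&0\\0&0&1\\0&0&0\end{pmatrix},\quad A_3=\begin{pmatrix}0&0&0\\1&0&0\\0&1&0\end{pmatrix}.$$ Moreover, two hom-Lie algebras $(\mathfrak{r}_{3,1},A_i)$ and $(\mathfrak{r}_{3,1},A_j)$ are isomorphic if and only if $A_i=A_j$.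
   Context: A complex hom-Lie algebra is a triple $(V,\cdot,A)$, where $V$ is a complex vector space, $\cdot$ is a skew-symmetric bilinear product on $V$, and $A:V\to V$ is a linear map (the twisting map) satisfying the hom-Jacobi identity $$\sum_{\sigma\in S_3}\operatorname{sign}(\sigma)\,Ax_{\sigma(1)}\cdot(x_{\sigma(2)}\cdot x_{\sigma(3)})=0\quad\text{for all }x_1,x_2,x_3\in V.$$ For a Lie algebra $\mathfrak{g}$, a hom-Lie algebra $(\mathfrak{g},A)$ is one whose product is the Lie bracket of $\mathfrak{g}$. An isomorphism of hom-Lie algebras $(V,\cdot,A)\to(U,\ast,B)$ is an invertible linear map $g:V\to U$ with $g(x\cdot y)=(gx)\ast(gy)$ for all $x,y\in V$ and $g\circ A=B\circ g$. In the matrix of a linear map, the $j$-th column is the coordinate vector of the image of $e_j$. *)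

theory Defs
  imports "HOL-Analysis.Analysis"
begin

locale skew_algebra = vector_space scale
  for scale :: "complex \<Rightarrow> 'a::ab_group_add \<Rightarrow> 'a" +
  fixes mult :: "'a \<Rightarrow> 'a \<Rightarrow> 'a"
  assumes linear_mult_left: "Vector_Spaces.linear scale scale (\<lambda>x. mult x y)"
    and linear_mult_right: "Vector_Spaces.linear scale scale (\<lambda>y. mult x y)"
    and mult_skew: "mult x y = - mult y x"

locale lie_algebra = skew_algebra scale mult
  for scale :: "complex \<Rightarrow> 'a::ab_group_add \<Rightarrow> 'a" and mult :: "'a \<Rightarrow> 'a \<Rightarrow> 'a" +
  assumes jacobi: "mult x (mult y z) + mult y (mult z x) + mult z (mult x y) = 0"

text \<open>The hom-Jacobi identity quantifies over a family \<open>x\<close> indexed by the natural numbers, of which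
  only the members at 1, 2, 3 matter.\<close>

locale hom_lie_algebra = skew_algebra scale mult
  for scale :: "complex \<Rightarrow> 'a::ab_group_add \<Rightarrow> 'a" and mult :: "'a \<Rightarrow> 'a \<Rightarrow> 'a" +
  fixes A :: "'a \<Rightarrow> 'a"
  assumes linear_twist: "Vector_Spaces.linear scale scale A"
    and hom_jacobi: "\<And>x :: nat \<Rightarrow> 'a.
      (\<Sum>\<sigma> | \<sigma> permutes {1, 2, 3}.
        scale (of_int (sign \<sigma>)) (mult (A (x (\<sigma> 1))) (mult (x (\<sigma> 2)) (x (\<sigma> 3))))) = 0"

definition hom_lie_iso ::
  "(complex \<Rightarrow> 'a::ab_group_add \<Rightarrow> 'a) \<Rightarrow> ('a \<Rightarrow> 'a \<Rightarrow> 'a) \<Rightarrow> ('a \<Rightarrow> 'a) \<Rightarrow>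
   (complex \<Rightarrow> 'b::ab_group_add \<Rightarrow> 'b) \<Rightarrow> ('b \<Rightarrow> 'b \<Rightarrow> 'b) \<Rightarrow> ('b \<Rightarrow> 'b) \<Rightarrow> ('a \<Rightarrow> 'b) \<Rightarrow> bool"
  where "hom_lie_iso s m A t n B g \<longleftrightarrow>
    Vector_Spaces.linear s t g \<and> bij g \<and> (\<forall>x y. g (m x y) = n (g x) (g y)) \<and> g \<circ> A = B \<circ> g"

definition hom_lie_isomorphic ::
  "(complex \<Rightarrow> 'a::ab_group_add \<Rightarrow> 'a) \<Rightarrow> ('a \<Rightarrow> 'a \<Rightarrow> 'a) \<Rightarrow> ('a \<Rightarrow> 'a) \<Rightarrow>
   (complex \<Rightarrow> 'b::ab_group_add \<Rightarrow> 'b) \<Rightarrow> ('b \<Rightarrow> 'b \<Rightarrow> 'b) \<Rightarrow> ('b \<Rightarrow> 'b) \<Rightarrow> bool"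
  where "hom_lie_isomorphic s m A t n B \<longleftrightarrow> (\<exists>g. hom_lie_iso s m A t n B g)"

definition nilpotent_map :: "('a::zero \<Rightarrow> 'a) \<Rightarrow> bool"
  where "nilpotent_map A \<longleftrightarrow> (\<exists>k. \<forall>x. (A ^^ k) x = 0)"

text \<open>The bilinear skew-symmetric extension of $[e_1,e_2]=e_2$, $[e_1,e_3]=e_3$, $[e_2,e_3]=0$,
  in coordinates; the lemmas below confirm that it is this extension.\<close>

definition r31 :: "complex^3 \<Rightarrow> complex^3 \<Rightarrow> complex^3"
  where "r31 x y = vector [0, x$1 * y$2 - x$2 * y$1, x$1 * y$3 - x$3 * y$1]"

lemma r31_axis:
  "r31 (axis 1 1) (axis 2 1) = axis 2 1"
  "r31 (axis 1 1) (axis 3 1) = axis 3 1"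
  "r31 (axis 2 1) (axis 3 1) = 0"
  by (simp_all add: r31_def vec_eq_iff forall_3 axis_def)

lemma lie_algebra_r31: "lie_algebra (*s) r31"
proof unfold_locales
  show "r31 x y = - r31 y x" for x y
    by (simp add: r31_def vec_eq_iff forall_3)
  show "r31 x (r31 y z) + r31 y (r31 z x) + r31 z (r31 x y) = 0" for x y z
    by (simp add: r31_def vec_eq_iff forall_3 algebra_simps)
qed (simp_all add: r31_def vec_eq_iff forall_3 algebra_simps)

text \<open>The twisting maps $A_0,\dots,A_3$; the matrices are written as vectors of rows. The value is
  meaningful only for indices up to 3.\<close>

definition twist31 :: "nat \<Rightarrow> complex^3 \<Rightarrow> complex^3"
  where "twist31 i =
    [\<lambda>_. 0,
     (*v) (vector [vector [0, 0, 0], vector [1, 0, 0], vector [0, 0, 0]]),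
     (*v) (vector [vector [0, 0, 0], vector [0, 0, 1], vector [0, 0, 0]]),
     (*v) (vector [vector [0, 0, 0], vector [1, 0, 0], vector [0, 1, 0]])] ! i"

end

theory Submission
  imports Defs
begin

text \<open>Write \<open>V\<close> for the derived algebra, the span of \<open>e\<^sub>2\<close> and \<open>e\<^sub>3\<close>. It is abelian and \<open>e\<^sub>1\<close> acts on it as
  the identity. Evaluated at \<open>e\<^sub>1, e\<^sub>2, e\<^sub>3\<close>, the hom-Jacobi identity says exactly that a twisting map
  \<open>A\<close> preserves \<open>V\<close> (\<open>hom_lie_algebra_r31_iff\<close>), and if \<open>A\<close> is nilpotent then it also maps \<open>e\<^sub>1\<close>
  into \<open>V\<close> and squares to zero on \<open>V\<close> (\<open>nilpotent_block_map\<close>).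

  The automorphisms of the Lie algebra are as many as one could hope for: \<open>e\<^sub>1\<close> may go to any vector
  of \<open>e\<^sub>1 + V\<close>, and \<open>e\<^sub>2, e\<^sub>3\<close> to any basis of \<open>V\<close>. So the classification amounts to choosing an
  adapted basis \<open>f\<^sub>1, f\<^sub>2, f\<^sub>3\<close> of this kind (\<open>r31_isomorphicI\<close>). Let \<open>u = A e\<^sub>1\<close>.
  \<^item> If \<open>A\<close> vanishes on \<open>V\<close>, it is zero or \<open>f\<^sub>2 = u\<close> leads to \<open>A\<^sub>1\<close>.
  \<^item> If \<open>A u \<noteq> 0\<close>, then \<open>e\<^sub>1, u, A u\<close> is a Jordan chain, which is \<open>A\<^sub>3\<close>.
  \<^item> If \<open>A u = 0\<close> but \<open>A v \<noteq> 0\<close> for some \<open>v \<in> V\<close>, then on \<open>V\<close> kernel and image of \<open>A\<close> are the same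
    line, so \<open>u\<close> is a multiple of \<open>A v\<close>; subtracting that multiple of \<open>v\<close> from \<open>e\<^sub>1\<close> gives \<open>f\<^sub>1\<close> with
    \<open>A f\<^sub>1 = 0\<close>, and \<open>f\<^sub>2 = A v\<close>, \<open>f\<^sub>3 = v\<close> lead to \<open>A\<^sub>2\<close>.

  The four normal forms are told apart by three properties that isomorphisms preserve: whether \<open>A\<close> is
  zero, whether \<open>A\<close> vanishes on all products, and whether \<open>A\<close> squares to zero
  (\<open>hom_lie_isomorphic_invariants\<close>, \<open>twist31_invariants\<close>).\<close>

section \<open>The hom-Jacobi identity\<close>

lemma sum_permutes_123:
  fixes f :: "(nat \<Rightarrow> nat) \<Rightarrow> 'a::comm_monoid_add"
  shows "(\<Sum>\<sigma> | \<sigma> permutes {1, 2, 3}. f \<sigma>) =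
    f id + f (Transposition.transpose 2 3) + f (Transposition.transpose 1 2)
      + f (Transposition.transpose 1 2 \<circ> Transposition.transpose 2 3)
      + f (Transposition.transpose 1 3) + f (Transposition.transpose 1 3 \<circ> Transposition.transpose 2 3)"
proof -
  have "finite {2::nat, 3}" "1 \<notin> {2::nat, 3}" "finite {3::nat}" "2 \<notin> {3::nat}"
    by auto
  then show ?thesis
    by (simp add: sum_over_permutations_insert add.assoc)
qed

context skew_algebra
begin

text \<open>By skew-symmetry in the inner bracket the odd permutations repeat the three even ones.\<close>

lemma sum_permutes_hom_jacobi:
  fixes A :: "'a \<Rightarrow> 'a" and x :: "nat \<Rightarrow> 'a"
  defines "cyc \<equiv> mult (A (x 1)) (mult (x 2) (x 3)) + mult (A (x 2)) (mult (x 3) (x 1))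
      + mult (A (x 3)) (mult (x 1) (x 2))"
  shows "(\<Sum>\<sigma> | \<sigma> permutes {1, 2, 3}.
        scale (of_int (sign \<sigma>)) (mult (A (x (\<sigma> 1))) (mult (x (\<sigma> 2)) (x (\<sigma> 3))))) = cyc + cyc"
proof -
  have neg: "mult a (mult b c) = - mult a (mult c b)" for a b c
  proof -
    interpret Vector_Spaces.linear scale scale "\<lambda>y. mult a y"
      by (rule linear_mult_right)
    show ?thesis
      by (subst mult_skew[of b c]) (rule neg)
  qed
  show ?thesis
    unfolding sum_permutes_123 cyc_def
    using neg[of "A (x 1)" "x 3" "x 2"] neg[of "A (x 2)" "x 1" "x 3"] neg[of "A (x 3)" "x 2" "x 1"]
    by (simp add: sign_compose permutation_swap_id sign_swap_id
        Transposition.transpose_def del: One_nat_def)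
qed

end

lemma hom_lie_algebra_iff_cyclic:
  fixes s :: "complex \<Rightarrow> 'a::ab_group_add \<Rightarrow> 'a"
  assumes "skew_algebra s m"
  shows "hom_lie_algebra s m A \<longleftrightarrow> Vector_Spaces.linear s s A \<and>
    (\<forall>x y z. m (A x) (m y z) + m (A y) (m z x) + m (A z) (m x y) = 0)"
proof -
  interpret skew_algebra s m by fact
  \<comment> \<open>The characteristic is not two.\<close>
  have dbl: "v + v = 0 \<longleftrightarrow> v = 0" for v :: 'a
    by (metis one_add_one scale_eq_0_iff scale_left_distrib scale_one zero_neq_numeral)
  show ?thesis
  proof
    assume "hom_lie_algebra s m A"
    then interpret hom_lie_algebra s m A .
    have "m (A x) (m y z) + m (A y) (m z x) + m (A z) (m x y) = 0" for x y z
    proof -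
      define f :: "nat \<Rightarrow> 'a" where "f n = (if n = 1 then x else if n = 2 then y else z)" for n
      show ?thesis
        using hom_jacobi[of f] unfolding sum_permutes_hom_jacobi dbl by (simp add: f_def)
    qed
    then show "Vector_Spaces.linear s s A \<and>
      (\<forall>x y z. m (A x) (m y z) + m (A y) (m z x) + m (A z) (m x y) = 0)"
      using linear_twist by blast
  next
    assume *: "Vector_Spaces.linear s s A \<and>
      (\<forall>x y z. m (A x) (m y z) + m (A y) (m z x) + m (A z) (m x y) = 0)"
    show "hom_lie_algebra s m A"
      unfolding hom_lie_algebra_def hom_lie_algebra_axioms_def
      unfolding sum_permutes_hom_jacobi dbl using * \<open>skew_algebra s m\<close> by blast
  qed
qed

section \<open>Isomorphisms\<close>

lemma hom_lie_isomorphic_refl: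
  assumes "vector_space s"
  shows "hom_lie_isomorphic s m A s m A"
proof -
  interpret vector_space s by fact
  show ?thesis
    unfolding hom_lie_isomorphic_def hom_lie_iso_def by (rule exI[of _ id]) (simp add: linear_id)
qed

lemma hom_lie_isomorphic_sym:
  assumes "hom_lie_isomorphic s m A t n B"
  shows "hom_lie_isomorphic t n B s m A"
proof -
  obtain g where lin: "Vector_Spaces.linear s t g" and bij: "bij g"
    and mult: "g (m x y) = n (g x) (g y)" and twist: "g \<circ> A = B \<circ> g" for x y
    using assms unfolding hom_lie_isomorphic_def hom_lie_iso_def by blast
  interpret g: Vector_Spaces.linear s t g by (fact lin)
  have inv: "inv g (g x) = x" "g (inv g y) = y" for x y
    using bij by (simp_all add: bij_is_inj bij_is_surj surj_f_inv_f)
  have eq: "inv g y = x \<longleftrightarrow> y = g x" for x y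
    using inv by metis
  have "Vector_Spaces.linear t s (inv g)"
    by unfold_locales (simp_all add: eq g.add g.scale inv)
  moreover have "inv g (n x y) = m (inv g x) (inv g y)" for x y
    by (simp add: eq mult inv)
  moreover have "inv g (B y) = A (inv g y)" for y
    using fun_cong[OF twist, of "inv g y"] by (simp add: eq inv)
  ultimately show ?thesis
    unfolding hom_lie_isomorphic_def hom_lie_iso_def
    using bij_imp_bij_inv[OF bij] by (auto intro!: exI[of _ "inv g"])
qed

text \<open>Three properties that will separate the normal forms. The middle one records whether the derived
  algebra lies in the kernel of the twisting map.\<close>

lemma hom_lie_isomorphic_invariants:
  assumes "hom_lie_isomorphic s m A t n B"
  shows "(\<forall>x. A x = 0) \<longleftrightarrow> (\<forall>x. B x = 0)"
    and "(\<forall>x y. A (m x y) = 0) \<longleftrightarrow> (\<forall>x y. B (n x y) = 0)"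
    and "(\<forall>x. A (A x) = 0) \<longleftrightarrow> (\<forall>x. B (B x) = 0)"
proof -
  obtain g where lin: "Vector_Spaces.linear s t g" and bij: "bij g"
    and mult: "g (m x y) = n (g x) (g y)" and twist: "g \<circ> A = B \<circ> g" for x y
    using assms unfolding hom_lie_isomorphic_def hom_lie_iso_def by blast
  interpret g: Vector_Spaces.linear s t g by (fact lin)
  have zero: "v = 0 \<longleftrightarrow> g v = 0" for v
    using injD[OF bij_is_inj[OF bij], of v 0] by auto
  have tw: "g (A x) = B (g x)" for x
    using fun_cong[OF twist, of x] by simp
  have all: "(\<forall>y. P y) \<longleftrightarrow> (\<forall>x. P (g x))" for P
  proof (intro iffI allI)
    fix y assume "\<forall>x. P (g x)"
    moreover obtain x where "y = g x"
      using bij_is_surj[OF bij] by (rule surjE)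
    ultimately show "P y" by simp
  qed simp
  show "(\<forall>x. A x = 0) \<longleftrightarrow> (\<forall>x. B x = 0)"
    unfolding all[of "\<lambda>y. B y = 0"] zero[of "A _"] tw ..
  show "(\<forall>x y. A (m x y) = 0) \<longleftrightarrow> (\<forall>x y. B (n x y) = 0)"
    unfolding all[of "\<lambda>x. \<forall>y. B (n x y) = 0"] all[of "\<lambda>y. B (n (g _) y) = 0"]
      zero[of "A _"] tw mult ..
  show "(\<forall>x. A (A x) = 0) \<longleftrightarrow> (\<forall>x. B (B x) = 0)"
    unfolding all[of "\<lambda>y. B (B y) = 0"] zero[of "A _"] tw ..
qed

section \<open>Twisting maps of $\mathfrak{r}_{3,1}$\<close>

text \<open>The linear maps that preserve the span of \<open>e\<^sub>2\<close> and \<open>e\<^sub>3\<close>: \<open>p, q, r, s\<close> are the entries, row by row,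
  of the restriction to that plane, and the image of \<open>e\<^sub>1\<close> is \<open>(a, u\<^sub>2, u\<^sub>3)\<close>.\<close>

definition block_map :: "complex \<Rightarrow> complex \<Rightarrow> complex \<Rightarrow> complex \<Rightarrow> complex \<Rightarrow> complex \<Rightarrow> complex
    \<Rightarrow> complex^3 \<Rightarrow> complex^3"
  where "block_map a u\<^sub>2 u\<^sub>3 p q r s x =
    vector [a * x$1, u\<^sub>2 * x$1 + p * x$2 + q * x$3, u\<^sub>3 * x$1 + r * x$2 + s * x$3]"

lemma block_map_nth [simp]:
  "block_map a u\<^sub>2 u\<^sub>3 p q r s x $ 1 = a * x$1"
  "block_map a u\<^sub>2 u\<^sub>3 p q r s x $ 2 = u\<^sub>2 * x$1 + p * x$2 + q * x$3"
  "block_map a u\<^sub>2 u\<^sub>3 p q r s x $ 3 = u\<^sub>3 * x$1 + r * x$2 + s * x$3"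
  by (simp_all add: block_map_def)

lemma r31_nth [simp]:
  "r31 x y $ 1 = 0"
  "r31 x y $ 2 = x$1 * y$2 - x$2 * y$1"
  "r31 x y $ 3 = x$1 * y$3 - x$3 * y$1"
  by (simp_all add: r31_def)

lemma block_map_eq_0_iff:
  "(\<forall>x. block_map a u\<^sub>2 u\<^sub>3 p q r s x = 0) \<longleftrightarrow>
    a = 0 \<and> u\<^sub>2 = 0 \<and> u\<^sub>3 = 0 \<and> p = 0 \<and> q = 0 \<and> r = 0 \<and> s = 0"
proof
  assume *: "\<forall>x. block_map a u\<^sub>2 u\<^sub>3 p q r s x = 0"
  show "a = 0 \<and> u\<^sub>2 = 0 \<and> u\<^sub>3 = 0 \<and> p = 0 \<and> q = 0 \<and> r = 0 \<and> s = 0"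
    using *[rule_format, of "axis 1 1"] *[rule_format, of "axis 2 1"] *[rule_format, of "axis 3 1"]
    by (simp add: vec_eq_iff forall_3 axis_def)
qed (simp add: vec_eq_iff forall_3)

lemma block_map_r31_eq_0_iff:
  "(\<forall>x y. block_map a u\<^sub>2 u\<^sub>3 p q r s (r31 x y) = 0) \<longleftrightarrow> p = 0 \<and> q = 0 \<and> r = 0 \<and> s = 0"
proof
  assume "\<forall>x y. block_map a u\<^sub>2 u\<^sub>3 p q r s (r31 x y) = 0"
  from this[rule_format, of "axis 1 1" "axis 2 1"] this[rule_format, of "axis 1 1" "axis 3 1"]
  show "p = 0 \<and> q = 0 \<and> r = 0 \<and> s = 0"
    by (simp add: r31_axis vec_eq_iff forall_3 axis_def)
qed (simp add: vec_eq_iff forall_3)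

lemma block_map_square:
  "block_map 0 u\<^sub>2 u\<^sub>3 p q r s (block_map 0 u\<^sub>2 u\<^sub>3 p q r s x) =
    block_map 0 (p * u\<^sub>2 + q * u\<^sub>3) (r * u\<^sub>2 + s * u\<^sub>3)
      (p * p + q * r) (p * q + q * s) (r * p + s * r) (r * q + s * s) x"
  by (simp add: vec_eq_iff forall_3 algebra_simps)

lemma linear_block_map: "Vector_Spaces.linear (*s) (*s) (block_map a u\<^sub>2 u\<^sub>3 p q r s)"
  by unfold_locales (simp_all add: vec_eq_iff forall_3 algebra_simps)

text \<open>As \<open>e\<^sub>2\<close> and \<open>e\<^sub>3\<close> commute, the cyclic sum at \<open>e\<^sub>1, e\<^sub>2, e\<^sub>3\<close> is \<open>A e\<^sub>3 \<cdot> e\<^sub>2 - A e\<^sub>2 \<cdot> e\<^sub>3\<close>, in which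
  only the \<open>e\<^sub>1\<close>-components of \<open>A e\<^sub>2\<close> and \<open>A e\<^sub>3\<close> survive, as coefficients of \<open>e\<^sub>3\<close> and \<open>e\<^sub>2\<close>.\<close>

lemma hom_lie_algebra_r31_iff:
  "hom_lie_algebra (*s) r31 A \<longleftrightarrow> (\<exists>a u\<^sub>2 u\<^sub>3 p q r s. A = block_map a u\<^sub>2 u\<^sub>3 p q r s)"
proof -
  interpret r31: lie_algebra "(*s)" r31 by (rule lie_algebra_r31)
  note iff = hom_lie_algebra_iff_cyclic[OF r31.skew_algebra_axioms]
  show ?thesis
  proof
    assume "hom_lie_algebra (*s) r31 A"
    then have lin: "Vector_Spaces.linear (*s) (*s) A"
      and cyc: "r31 (A x) (r31 y z) + r31 (A y) (r31 z x) + r31 (A z) (r31 x y) = 0" for x y z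
      unfolding iff by blast+
    define M where "M = matrix A"
    have A: "A x = M *v x" for x
      using matrix_works[OF lin] by (simp add: M_def)
    have "M$1$2 = 0" "M$1$3 = 0"
      using cyc[of "axis 1 1" "axis 2 1" "axis 3 1"]
      by (simp_all add: A vec_eq_iff forall_3 matrix_vector_mult_def sum_3 axis_def)
    then have "A = block_map (M$1$1) (M$2$1) (M$3$1) (M$2$2) (M$2$3) (M$3$2) (M$3$3)"
      by (simp add: fun_eq_iff A vec_eq_iff forall_3 matrix_vector_mult_def sum_3)
    then show "\<exists>a u\<^sub>2 u\<^sub>3 p q r s. A = block_map a u\<^sub>2 u\<^sub>3 p q r s" by blast
  next
    assume "\<exists>a u\<^sub>2 u\<^sub>3 p q r s. A = block_map a u\<^sub>2 u\<^sub>3 p q r s"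
    then obtain a u\<^sub>2 u\<^sub>3 p q r s where A: "A = block_map a u\<^sub>2 u\<^sub>3 p q r s" by blast
    show "hom_lie_algebra (*s) r31 A"
      unfolding iff A using linear_block_map
      by (simp add: vec_eq_iff forall_3 algebra_simps)
  qed
qed

text \<open>The map acts on the quotient by the plane as multiplication by \<open>a\<close>, which must be nilpotent. On
  the plane, Cayley-Hamilton reads \<open>A\<^sup>2 = t A - d\<close> with trace \<open>t\<close> and determinant \<open>d\<close>. If \<open>d \<noteq> 0\<close>, then
  \<open>A\<close> is injective there; and once \<open>d = 0\<close>, \<open>A\<^sup>n A = t\<^sup>n A\<close> forces \<open>t = 0\<close>.\<close>

lemma nilpotent_block_map:
  assumes "nilpotent_map (block_map a u\<^sub>2 u\<^sub>3 p q r s)"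
  shows "a = 0" and "p + s = 0" and "p * s = q * r"
proof -
  let ?A = "block_map a u\<^sub>2 u\<^sub>3 p q r s"
  obtain k where k: "(?A ^^ k) x = 0" for x
    using assms unfolding nilpotent_map_def by blast
  have "(?A ^^ n) x $ 1 = a ^ n * x $ 1" for n x
    by (induction n) simp_all
  from this[of k "axis 1 1"] show "a = 0"
    by (simp add: k)
  define t d where "t = p + s" and "d = p * s - q * r"
  have ch: "?A (?A v) = t *s ?A v - d *s v" if "v$1 = 0" for v
    using that by (simp add: vec_eq_iff forall_3 t_def d_def algebra_simps)
  have d: "d = 0"
  proof (rule ccontr)
    assume "d \<noteq> 0"
    have inj: "v = 0" if "v$1 = 0" "?A v = 0" for v
    proof -
      have "?A 0 = 0" by (simp add: vec_eq_iff forall_3)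
      then have "d *s v = 0" using ch[OF that(1)] that(2) by simp
      then show ?thesis using \<open>d \<noteq> 0\<close> by simp
    qed
    have "(?A ^^ n) (axis 2 1) $ 1 = 0 \<and> (?A ^^ n) (axis 2 1) \<noteq> 0" for n
    proof (induction n)
      case 0
      show ?case by (simp add: axis_eq_0_iff) (simp add: axis_def)
    next
      case (Suc n)
      then show ?case using inj[of "(?A ^^ n) (axis 2 1)"] by auto
    qed
    then show False using k by blast
  qed
  show "p * s = q * r" using d by (simp add: d_def)
  have pow: "(?A ^^ n) (?A v) = t ^ n *s ?A v" if "v$1 = 0" for n v
  proof (induction n)
    case (Suc n)
    interpret Vector_Spaces.linear "(*s)" "(*s)" ?A by (rule linear_block_map)
    show ?case using Suc ch[OF that] d by (simp add: scale)
  qed simp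
  have "t ^ k *s ?A (axis 2 1) = 0" "t ^ k *s ?A (axis 3 1) = 0"
    using pow[of "axis 2 1" k] pow[of "axis 3 1" k] k by (simp_all add: axis_def)
  then have "t = 0 \<or> p = 0 \<and> s = 0"
    by (auto simp: vec_eq_iff forall_3 axis_def)
  then show "p + s = 0" by (auto simp: t_def)
qed

section \<open>Classification\<close>

text \<open>The linear map \<open>h\<close> that takes \<open>e\<^sub>i\<close> to \<open>f\<^sub>i\<close> is an automorphism of the Lie algebra, because
  the bracket of \<open>x\<close> and \<open>y\<close> is \<open>x\<^sub>1 y - y\<^sub>1 x\<close> and \<open>h\<close> preserves \<open>e\<^sub>1\<close>-components. The last hypothesis says that \<open>A\<close> has the matrix of \<open>B\<close> with respect to the basis \<open>f\<^sub>1, f\<^sub>2, f\<^sub>3\<close>.\<close>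

lemma r31_isomorphicI:
  fixes f\<^sub>1 f\<^sub>2 f\<^sub>3 :: "complex^3"
  defines "h \<equiv> \<lambda>x. x$1 *s f\<^sub>1 + x$2 *s f\<^sub>2 + x$3 *s f\<^sub>3"
  assumes A: "Vector_Spaces.linear (*s) (*s) A"
    and f: "f\<^sub>1$1 = 1" "f\<^sub>2$1 = 0" "f\<^sub>3$1 = 0" "f\<^sub>2$2 * f\<^sub>3$3 \<noteq> f\<^sub>2$3 * f\<^sub>3$2"
    and AB: "\<And>x. x$1 *s A f\<^sub>1 + x$2 *s A f\<^sub>2 + x$3 *s A f\<^sub>3 = h (B x)"
  shows "hom_lie_isomorphic (*s) r31 A (*s) r31 B"
proof (rule hom_lie_isomorphic_sym)
  interpret A: Vector_Spaces.linear "(*s)" "(*s)" A by (fact A)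
  have lin: "Vector_Spaces.linear (*s) (*s) h"
    by unfold_locales (simp_all add: h_def vec_eq_iff algebra_simps)
  have "x = 0" if "h x = 0" for x
  proof -
    let ?D = "f\<^sub>2$2 * f\<^sub>3$3 - f\<^sub>2$3 * f\<^sub>3$2"
    have 1: "x$1 = 0"
      using that f by (simp add: h_def vec_eq_iff forall_3)
    then have e: "x$2 * f\<^sub>2$2 + x$3 * f\<^sub>3$2 = 0" "x$2 * f\<^sub>2$3 + x$3 * f\<^sub>3$3 = 0"
      using that by (simp_all add: h_def vec_eq_iff forall_3)
    have "?D * x$2 = 0" "?D * x$3 = 0"
      using e by algebra+
    then show ?thesis
      using 1 f(4) by (simp add: vec_eq_iff forall_3)
  qed
  then have "inj h"
    using vec.linear_inj_iff_eq_0[OF lin] by blast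
  then have bij: "bij h"
    using vec.linear_inj_imp_surj[OF lin] by (simp add: bij_def)
  have mult: "h (r31 x y) = r31 (h x) (h y)" for x y
    using f(1-3) by (simp add: h_def vec_eq_iff forall_3 algebra_simps)
  have "A (h x) = h (B x)" for x
    unfolding AB[symmetric] by (simp add: h_def A.add A.scale)
  then show "hom_lie_isomorphic (*s) r31 B (*s) r31 A"
    unfolding hom_lie_isomorphic_def hom_lie_iso_def
    using lin bij mult by (auto intro!: exI[of _ h])
qed

lemma twist31_block_map:
  "twist31 0 = block_map 0 0 0 0 0 0 0"
  "twist31 (Suc 0) = block_map 0 1 0 0 0 0 0"
  "twist31 2 = block_map 0 0 0 0 1 0 0"
  "twist31 3 = block_map 0 1 0 0 0 1 0"
  by (simp_all add: fun_eq_iff twist31_def vec_eq_iff forall_3 matrix_vector_mult_def sum_3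
      numeral_3_eq_3 numeral_2_eq_2)

lemma nilpotent_r31_classification:
  assumes A: "A = block_map 0 u\<^sub>2 u\<^sub>3 p q r s" and tr: "p + s = 0" and det: "p * s = q * r"
  shows "\<exists>i\<in>{0, 1, 2, 3}. hom_lie_isomorphic (*s) r31 A (*s) r31 (twist31 i)"
proof -
  have lin: "Vector_Spaces.linear (*s) (*s) A"
    unfolding A by (rule linear_block_map)
  have s: "s = - p" using tr by (simp add: add_eq_0_iff)
  have pp: "p * p = - (q * r)" using tr det by algebra
  consider (zero) "q = 0" "r = 0" "u\<^sub>2 = 0" "u\<^sub>3 = 0"
    | (rank1) "q = 0" "r = 0" "u\<^sub>2 \<noteq> 0 \<or> u\<^sub>3 \<noteq> 0"
    | (square) "p * u\<^sub>2 + q * u\<^sub>3 \<noteq> 0 \<or> r * u\<^sub>2 + s * u\<^sub>3 \<noteq> 0"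
    | (rank1V) "p * u\<^sub>2 + q * u\<^sub>3 = 0" "r * u\<^sub>2 + s * u\<^sub>3 = 0" "q \<noteq> 0 \<or> r \<noteq> 0"
    by blast
  then show ?thesis
  proof cases
    case zero
    then have "p = 0" using pp by simp
    then have "A = twist31 0" using zero s by (simp add: A twist31_block_map)
    then show ?thesis using hom_lie_isomorphic_refl[OF vec.vector_space_axioms] by auto
  next
    case rank1
    then have p: "p = 0" using pp by simp
    define f\<^sub>3 :: "complex^3" where "f\<^sub>3 = (if u\<^sub>2 = 0 then axis 2 1 else axis 3 1)"
    have "hom_lie_isomorphic (*s) r31 A (*s) r31 (twist31 1)"
      using rank1 p s
      by (intro r31_isomorphicI[OF lin, of "axis 1 1" "vector [0, u\<^sub>2, u\<^sub>3]" f\<^sub>3])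
        (auto simp: f\<^sub>3_def axis_def A twist31_block_map vec_eq_iff forall_3)
    then show ?thesis by blast
  next
    case square
    define v\<^sub>2 v\<^sub>3 where "v\<^sub>2 = p * u\<^sub>2 + q * u\<^sub>3" and "v\<^sub>3 = r * u\<^sub>2 + s * u\<^sub>3"
    \<comment> \<open>\<open>(v\<^sub>2, v\<^sub>3)\<close> is \<open>A\<^sup>2 e\<^sub>1\<close>, and \<open>A\<^sup>3 e\<^sub>1 = 0\<close>.\<close>
    have v: "p * v\<^sub>2 + q * v\<^sub>3 = 0" "r * v\<^sub>2 + s * v\<^sub>3 = 0"
      using tr det unfolding v\<^sub>2_def v\<^sub>3_def by algebra+
    \<comment> \<open>If \<open>u\<close> and \<open>A u\<close> were dependent, \<open>u\<close> would be an eigenvector and \<open>A u\<close> would vanish. In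
      coordinates: the determinant of the two vectors divides the squares of both entries of \<open>A u\<close>.\<close>
    have "v\<^sub>2 ^ 2 = q * (u\<^sub>3 * v\<^sub>2 - u\<^sub>2 * v\<^sub>3)" "v\<^sub>3 ^ 2 = r * (u\<^sub>2 * v\<^sub>3 - u\<^sub>3 * v\<^sub>2)"
      using tr det unfolding v\<^sub>2_def v\<^sub>3_def by algebra+
    then have "u\<^sub>2 * v\<^sub>3 \<noteq> u\<^sub>3 * v\<^sub>2"
      using square unfolding v\<^sub>2_def[symmetric] v\<^sub>3_def[symmetric] by auto
    then have "hom_lie_isomorphic (*s) r31 A (*s) r31 (twist31 3)"
      using v
      by (intro r31_isomorphicI[OF lin, of "axis 1 1" "vector [0, u\<^sub>2, u\<^sub>3]" "vector [0, v\<^sub>2, v\<^sub>3]"])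
        (auto simp: axis_def A twist31_block_map vec_eq_iff forall_3 v\<^sub>2_def[symmetric]
          v\<^sub>3_def[symmetric] algebra_simps)
    then show ?thesis by blast
  next
    case rank1V
    \<comment> \<open>The second or the third basis vector serves as \<open>v\<close>, according to whether \<open>A e\<^sub>2\<close> is nonzero,
      that is \<open>r \<noteq> 0\<close>; the correction in \<open>w\<close> is the multiple of \<open>v\<close> that \<open>A\<close> sends to \<open>A e\<^sub>1\<close>.\<close>
    obtain w v where w: "w$1 = 1" and v: "v$1 = 0" and Aw: "A w = 0" and AAv: "A (A v) = 0"
      and indep: "(A v)$2 * v$3 \<noteq> (A v)$3 * v$2"
    proof (cases "r = 0")
      case False
      show ?thesis
        by (rule that[of "vector [1, - u\<^sub>3 / r, 0]" "axis 2 1"])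
          (use False rank1V pp in \<open>auto simp: A axis_def vec_eq_iff forall_3 s field_simps\<close>)
    next
      case True
      then have "p = 0" "q \<noteq> 0" using pp rank1V by auto
      show ?thesis
        by (rule that[of "vector [1, 0, - u\<^sub>2 / q]" "axis 3 1"])
          (use True \<open>p = 0\<close> \<open>q \<noteq> 0\<close> rank1V in
            \<open>auto simp: A axis_def vec_eq_iff forall_3 s field_simps\<close>)
    qed
    have "(A v)$1 = 0" by (simp add: A)
    then have "hom_lie_isomorphic (*s) r31 A (*s) r31 (twist31 2)"
      using w v Aw AAv indep
      by (intro r31_isomorphicI[OF lin, of w "A v" v]) (auto simp: twist31_block_map)
    then show ?thesis by blast
  qed
qed

lemma twist31_invariants:
  assumes "i \<in> {0, 1, 2, 3}"
  shows "(\<forall>x. twist31 i x = 0) \<longleftrightarrow> i = 0"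
    and "(\<forall>x y. twist31 i (r31 x y) = 0) \<longleftrightarrow> i \<le> 1"
    and "(\<forall>x. twist31 i (twist31 i x) = 0) \<longleftrightarrow> i \<le> 2"
  using assms
  by (elim insertE; simp add: twist31_block_map block_map_square
      block_map_eq_0_iff block_map_r31_eq_0_iff)+

theorem proposition3p6:
  shows "(\<forall>i\<in>{0, 1, 2, 3}. hom_lie_algebra (*s) r31 (twist31 i)) \<and>
    (\<forall>A. hom_lie_algebra (*s) r31 A \<and> nilpotent_map A \<longrightarrow>
      (\<exists>i\<in>{0, 1, 2, 3}. hom_lie_isomorphic (*s) r31 A (*s) r31 (twist31 i))) \<and>
    (\<forall>i\<in>{0, 1, 2, 3}. \<forall>j\<in>{0, 1, 2, 3}.
      hom_lie_isomorphic (*s) r31 (twist31 i) (*s) r31 (twist31 j) \<longleftrightarrow> twist31 i = twist31 j)"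
proof (intro conjI ballI allI impI)
  fix i :: nat assume "i \<in> {0, 1, 2, 3}"
  then show "hom_lie_algebra (*s) r31 (twist31 i)"
    unfolding hom_lie_algebra_r31_iff
    by (elim insertE; simp add: twist31_block_map) blast+
next
  fix A assume A: "hom_lie_algebra (*s) r31 A \<and> nilpotent_map A"
  then obtain a u\<^sub>2 u\<^sub>3 p q r s where block: "A = block_map a u\<^sub>2 u\<^sub>3 p q r s"
    unfolding hom_lie_algebra_r31_iff by blast
  with A have "nilpotent_map (block_map a u\<^sub>2 u\<^sub>3 p q r s)" by simp
  note nilpotent_block_map[OF this]
  then show "\<exists>i\<in>{0, 1, 2, 3}. hom_lie_isomorphic (*s) r31 A (*s) r31 (twist31 i)"
    using nilpotent_r31_classification block by blast
next
  fix i j :: nat assume ij: "i \<in> {0, 1, 2, 3}" "j \<in> {0, 1, 2, 3}"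
  show "hom_lie_isomorphic (*s) r31 (twist31 i) (*s) r31 (twist31 j) \<longleftrightarrow> twist31 i = twist31 j"
  proof
    assume "hom_lie_isomorphic (*s) r31 (twist31 i) (*s) r31 (twist31 j)"
    note this[THEN hom_lie_isomorphic_invariants(1)] this[THEN hom_lie_isomorphic_invariants(2)]
      this[THEN hom_lie_isomorphic_invariants(3)]
    then have "i = 0 \<longleftrightarrow> j = 0" "i \<le> 1 \<longleftrightarrow> j \<le> 1" "i \<le> 2 \<longleftrightarrow> j \<le> 2"
      unfolding twist31_invariants[OF ij(1)] twist31_invariants[OF ij(2)] .
    then have "i = j" using ij by auto
    then show "twist31 i = twist31 j" by simp
  next
    assume "twist31 i = twist31 j"
    then show "hom_lie_isomorphic (*s) r31 (twist31 i) (*s) r31 (twist31 j)"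
      using hom_lie_isomorphic_refl[OF vec.vector_space_axioms] by metis
  qed
qed

end
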